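(* Let $\varepsilon>0$, let $n$ be a sufficiently large integer and let $b=(1-\varepsilon)n$. Then in the $(1:b)$ random-Breaker perfect-matching game played on $E(K_{n,n})$, Maker has a strategy which is w.h.p.\ a winning strategy, and with it he wins within $(1+o(1))n$ rounds.
   Context: The $(1:b)$ random-Breaker game on the board $E(K_{n,n})$ (the complete bipartite graph with two parts of size $n$): Maker and Breaker alternately claim previously unclaimed edges, Breaker moving first. In each round Breaker claims $b$ edges chosen uniformly at random among all unclaimed edges, and then Maker claims one unclaimed edge of his choice. Maker wins if his graph contains a perfect matching of $K_{n,n}$. "W.h.p." means with probability tending to $1$ as $n\to\infty$. *)

theory Defs
  imports "HOL-Probability.Probability"
begin

text \<open>
  The pair \<open>(i, j)\<close> stands for the edge joining the \<open>i\<close>-th vertex of the first part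
  to the \<open>j\<close>-th vertex of the second part.
\<close>

type_synonym edge = "nat \<times> nat"

definition board :: "nat \<Rightarrow> edge set" where
  "board n = {..<n} \<times> {..<n}"

definition perfect_matching :: "nat \<Rightarrow> edge set \<Rightarrow> bool" where
  "perfect_matching n M \<longleftrightarrow>
     M \<subseteq> board n \<and> (\<forall>i<n. \<exists>!e. e \<in> M \<and> fst e = i) \<and> (\<forall>j<n. \<exists>!e. e \<in> M \<and> snd e = j)"

text \<open>
  A round consists of the set of edges claimed by Breaker, who moves first, and the edge then
  claimed by Maker; the latter is \<open>None\<close> iff Breaker has left no unclaimed edge.
  Histories list the rounds in chronological order.
\<close>

type_synonym history = "(edge set \<times> edge option) list"

definition breaker_edges :: "history \<Rightarrow> edge set" where
  "breaker_edges h = {e. \<exists>(B, m) \<in> set h. e \<in> B}"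

definition maker_edges :: "history \<Rightarrow> edge set" where
  "maker_edges h = {e. \<exists>(B, m) \<in> set h. m = Some e}"

definition unclaimed :: "nat \<Rightarrow> history \<Rightarrow> edge set" where
  "unclaimed n h = board n - (breaker_edges h \<union> maker_edges h)"

text \<open>
  Maker's move depends on the completed rounds and on Breaker's move in the current round.
\<close>

type_synonym strategy = "history \<Rightarrow> edge set \<Rightarrow> edge"

definition legal_strategy :: "nat \<Rightarrow> strategy \<Rightarrow> bool" where
  "legal_strategy n S \<longleftrightarrow>
     (\<forall>h B. B \<subseteq> unclaimed n h \<longrightarrow> unclaimed n h - B \<noteq> {} \<longrightarrow> S h B \<in> unclaimed n h - B)"

text \<open>
  If fewer than \<open>b\<close> edges are left, Breaker claims all of them.
\<close>

definition breaker_move :: "nat \<Rightarrow> nat \<Rightarrow> history \<Rightarrow> edge set pmf" where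
  "breaker_move n b h =
     pmf_of_set {B. B \<subseteq> unclaimed n h \<and> card B = min b (card (unclaimed n h))}"

definition maker_move :: "nat \<Rightarrow> strategy \<Rightarrow> history \<Rightarrow> edge set \<Rightarrow> edge option" where
  "maker_move n S h B = (if unclaimed n h - B = {} then None else Some (S h B))"

text \<open>
  The distribution of the history after \<open>k\<close> rounds of the \<open>(1:b)\<close> game. Play formally goes on
  after Maker has won and after the board is exhausted, which does not affect
  whether Maker has won within \<open>k\<close> rounds.
\<close>

primrec play :: "nat \<Rightarrow> nat \<Rightarrow> strategy \<Rightarrow> nat \<Rightarrow> history pmf" where
  "play n b S 0 = return_pmf []"
| "play n b S (Suc k) =
     bind_pmf (play n b S k)
       (\<lambda>h. map_pmf (\<lambda>B. h @ [(B, maker_move n S h B)]) (breaker_move n b h))"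

definition maker_wins :: "nat \<Rightarrow> history \<Rightarrow> bool" where
  "maker_wins n h \<longleftrightarrow> (\<exists>M \<subseteq> maker_edges h. perfect_matching n M)"

definition prob_win_within :: "nat \<Rightarrow> nat \<Rightarrow> strategy \<Rightarrow> nat \<Rightarrow> real" where
  "prob_win_within n b S k = measure_pmf.prob (play n b S k) {h. maker_wins n h}"

end

theory Submission
  imports Defs "HOL-Combinatorics.Permutations" "HOL-Real_Asymp.Real_Asymp"
begin

text \<open>
  Whatever Maker does, a fixed set \<open>W\<close> of edges is entirely claimed by Breaker within \<open>k\<close> rounds with
  probability at most \<open>(k (b + 1) / n\<^sup>2) ^ |W|\<close>. For \<open>k = (1 + o(1)) n\<close> the base is bounded away from 1, so
  with \<open>m\<close> about \<open>n\<close> to the power \<open>1/3\<close> a union bound shows that w.h.p. Breaker's final graph contains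
  no complete bipartite graph with parts of size \<open>m\<close> and that every vertex keeps at least \<open>m\<close> edges
  not claimed by Breaker.

  On this event Maker wins within \<open>n + 2 m\<^sup>2\<close> rounds. He first builds a matching greedily, which cannot
  get stuck while more than \<open>m\<close> vertices of each part are uncovered. He then gives each of the \<open>2 m\<close>
  uncovered vertices degree \<open>m\<close>. Now let \<open>u\<close> and \<open>v\<close> be uncovered vertices in different parts; the
  partners of their neighbours form two sets of size \<open>m\<close>, joined by an edge that Breaker has not
  claimed. Claiming this edge completes an augmenting path of length 5 from \<open>u\<close> to \<open>v\<close>, so each
  remaining pair costs one further round.
\<close>

section \<open>Uniform random subsets of fixed size\<close>

text \<open>In the product formula for \<open>(b choose d) / (a choose d)\<close> every factor
  \<open>(b - i) / (a - i)\<close> is at most \<open>b / a\<close>. Cleared of denominators, this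
  also covers \<open>d > b\<close>.\<close>

lemma binomial_mult_power_le:
  fixes a b d :: nat
  assumes "b \<le> a"
  shows "(b choose d) * a ^ d \<le> (a choose d) * b ^ d"
proof (induction d)
  case 0
  then show ?case by simp
next
  case (Suc d)
  have binom: "(k choose Suc d) * Suc d = (k choose d) * (k - d)" for k
    using binomial_absorption[of d k] binomial_absorb_comp[of k d]
    by (cases k) (simp_all add: mult.commute)
  have fac: "(b - d) * a \<le> (a - d) * b"
    using diff_le_mono2[OF mult_le_mono2[OF assms, of d], of "b * a"]
    by (simp only: diff_mult_distrib mult.commute[of a b])
  have "(b choose Suc d) * a ^ Suc d * Suc d = ((b choose Suc d) * Suc d) * a ^ Suc d"
    by (simp only: mult_ac)
  also have "\<dots> = ((b choose d) * a ^ d) * ((b - d) * a)"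
    unfolding binom by (simp only: power_Suc mult_ac)
  also have "\<dots> \<le> ((a choose d) * b ^ d) * ((a - d) * b)"
    by (intro mult_le_mono Suc.IH fac)
  also have "\<dots> = ((a choose Suc d) * Suc d) * b ^ Suc d"
    unfolding binom by (simp only: power_Suc mult_ac)
  also have "\<dots> = (a choose Suc d) * b ^ Suc d * Suc d"
    by (simp only: mult_ac)
  finally show ?case by (simp only: mult_le_cancel2)
qed

lemma card_supersets_of_card:
  assumes "finite U" "D \<subseteq> U" "card D \<le> b"
  shows "card {B. B \<subseteq> U \<and> card B = b \<and> D \<subseteq> B} = (card U - card D) choose (b - card D)"
proof -
  have finD: "finite D" using assms finite_subset by blast
  have "bij_betw (\<lambda>B. B - D) {B. B \<subseteq> U \<and> card B = b \<and> D \<subseteq> B}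
          {C. C \<subseteq> U - D \<and> card C = b - card D}"
  proof (rule bij_betwI[where g = "\<lambda>C. C \<union> D"])
    show "(\<lambda>B. B - D) \<in> {B. B \<subseteq> U \<and> card B = b \<and> D \<subseteq> B} \<rightarrow> {C. C \<subseteq> U - D \<and> card C = b - card D}"
      using finD by (auto simp: card_Diff_subset)
    show "(\<lambda>C. C \<union> D) \<in> {C. C \<subseteq> U - D \<and> card C = b - card D} \<rightarrow> {B. B \<subseteq> U \<and> card B = b \<and> D \<subseteq> B}"
    proof safe
      fix C assume C: "C \<subseteq> U - D" "card C = b - card D"
      have "finite C" using C assms by (meson finite_Diff finite_subset)
      then show "card (C \<union> D) = b"
        using C assms finD by (subst card_Un_disjoint) auto
    qed (use assms in auto)
  qed auto
  then have "card {B. B \<subseteq> U \<and> card B = b \<and> D \<subseteq> B} = card {C. C \<subseteq> U - D \<and> card C = b - card D}"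
    by (rule bij_betw_same_card)
  also have "\<dots> = (card U - card D) choose (b - card D)"
    using assms finD by (subst n_subsets) (auto simp: card_Diff_subset)
  finally show ?thesis .
qed

text \<open>For \<open>D\<close> inside \<open>U\<close>, the identity \<open>(u choose b) * (b
  choose d) = (u choose d) * ((u - d) choose (b - d))\<close> shows that a uniform
  \<open>b\<close>-subset contains \<open>D\<close> with probability
  \<open>(b choose d) / (u choose d)\<close>, hence at most \<open>(b / u) ^ d\<close>.\<close>

lemma card_supersets_of_card_le:
  fixes D U :: "'a set"
  assumes "finite U" "b \<le> card U" "card U > 0" "finite D"
  shows "real (card {B. B \<subseteq> U \<and> card B = b \<and> D \<subseteq> B})
           \<le> real (card U choose b) * (real b / real (card U)) ^ card D"
proof (cases "D \<subseteq> U \<and> card D \<le> b")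
  case True
  define u d where "u = card U" and "d = card D"
  have du: "d \<le> b" "b \<le> u" "u > 0" using True assms by (auto simp: u_def d_def)
  have *: "(u choose b) * (b choose d) = (u choose d) * ((u - d) choose (b - d))"
    using du by (intro choose_mult) auto
  have pos: "(u choose d) > 0" using du by simp
  have "((u - d) choose (b - d)) * u ^ d * (u choose d) = (u choose b) * ((b choose d) * u ^ d)"
    using * by (simp add: algebra_simps)
  also have "\<dots> \<le> (u choose b) * ((u choose d) * b ^ d)"
    using binomial_mult_power_le[OF du(2), of d] by (rule mult_le_mono2)
  also have "\<dots> = (u choose b) * b ^ d * (u choose d)" by simp
  finally have "((u - d) choose (b - d)) * u ^ d \<le> (u choose b) * b ^ d"
    using pos by (simp only: mult_le_cancel2)
  then have "real ((u - d) choose (b - d)) * real u ^ d \<le> real (u choose b) * real b ^ d"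
    by (metis of_nat_le_iff of_nat_mult of_nat_power)
  then have "real ((u - d) choose (b - d)) \<le> real (u choose b) * (real b / real u) ^ d"
    using du by (simp add: power_divide field_simps)
  then show ?thesis
    using card_supersets_of_card[OF assms(1)] True by (simp add: u_def d_def)
next
  case False
  have "False" if "B \<subseteq> U" "card B = b" "D \<subseteq> B" for B
    using False that assms(1) card_mono[of B D] finite_subset[of B U] by auto
  then have "{B. B \<subseteq> U \<and> card B = b \<and> D \<subseteq> B} = {}" by blast
  then have "card {B. B \<subseteq> U \<and> card B = b \<and> D \<subseteq> B} = 0" by (simp only: card.empty)
  then show ?thesis by simp
qed

text \<open>An edge \<open>e\<close> of \<open>W\<close> contributes the factor
  \<open>t + (1 - t) * of_bool (e \<in> B)\<close>. Multiplying out over \<open>W\<close> gives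
  events \<open>D \<subseteq> B\<close> with nonnegative coefficients. Each is bounded as if edges
  entered \<open>B\<close> independently, and then the sum factors again.\<close>

lemma sum_power_card_diff_le:
  fixes t :: real
  assumes "finite U" "b \<le> card U" "card U > 0" "finite W" "0 \<le> t" "t \<le> 1"
  shows "(\<Sum>B | B \<subseteq> U \<and> card B = b. t ^ card (W - B))
           \<le> real (card U choose b) * (t + (1 - t) * (real b / real (card U))) ^ card W"
proof -
  let ?S = "{B. B \<subseteq> U \<and> card B = b}"
  have finS: "finite ?S" using assms(1) by simp
  let ?p = "real b / real (card U)"
  have expand: "t ^ card (W - B) = (\<Sum>D\<in>Pow W. (1 - t) ^ card D * t ^ card (W - D) * of_bool (D \<subseteq> B))" for B
  proof -
    have "t ^ card (W - B) = (\<Prod>e\<in>W - B. t)" by simp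
    also have "\<dots> = (\<Prod>e\<in>W. if e \<in> B then 1 else t)"
      using assms(4) by (intro prod.mono_neutral_cong_left) auto
    also have "\<dots> = (\<Prod>e\<in>W. (1 - t) * of_bool (e \<in> B) + t)"
      by (intro prod.cong) auto
    also have "\<dots> = (\<Sum>D\<in>Pow W. (\<Prod>e\<in>D. (1 - t) * of_bool (e \<in> B)) * (\<Prod>e\<in>W - D. t))"
      using assms(4) by (rule prod_add)
    also have "\<dots> = (\<Sum>D\<in>Pow W. (1 - t) ^ card D * t ^ card (W - D) * of_bool (D \<subseteq> B))"
    proof (intro sum.cong refl)
      fix D assume "D \<in> Pow W"
      then have "finite D" using assms(4) finite_subset by auto
      then have "(\<Prod>e\<in>D. of_bool (e \<in> B) :: real) = of_bool (D \<subseteq> B)"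
        by (auto simp: subset_iff)
      then show "(\<Prod>e\<in>D. (1 - t) * of_bool (e \<in> B)) * (\<Prod>e\<in>W - D. t)
          = (1 - t) ^ card D * t ^ card (W - D) * of_bool (D \<subseteq> B)"
        by (simp add: prod.distrib)
    qed
    finally show ?thesis .
  qed
  have "(\<Sum>B\<in>?S. t ^ card (W - B))
      = (\<Sum>D\<in>Pow W. (1 - t) ^ card D * t ^ card (W - D) * (\<Sum>B\<in>?S. of_bool (D \<subseteq> B)))"
    by (subst expand, subst sum.swap) (simp add: sum_distrib_left)
  also have "\<dots> \<le> (\<Sum>D\<in>Pow W. (1 - t) ^ card D * t ^ card (W - D) * (real (card U choose b) * ?p ^ card D))"
  proof (intro sum_mono mult_left_mono)
    fix D assume D: "D \<in> Pow W"
    then have "finite D" using assms(4) finite_subset by auto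
    have "(\<Sum>B\<in>?S. of_bool (D \<subseteq> B) :: real) = real (card {B \<in> ?S. D \<subseteq> B})"
      using finS by (simp add: of_bool_def sum.If_cases Int_def)
    also have "{B \<in> ?S. D \<subseteq> B} = {B. B \<subseteq> U \<and> card B = b \<and> D \<subseteq> B}" by auto
    also have "real (card \<dots>) \<le> real (card U choose b) * ?p ^ card D"
      using card_supersets_of_card_le[OF assms(1,2,3) \<open>finite D\<close>] .
    finally show "(\<Sum>B\<in>?S. of_bool (D \<subseteq> B)) \<le> real (card U choose b) * ?p ^ card D" .
  qed (use assms in auto)
  also have "\<dots> = real (card U choose b) * (\<Sum>D\<in>Pow W. (\<Prod>e\<in>D. (1 - t) * ?p) * (\<Prod>e\<in>W - D. t))"
    by (simp add: sum_distrib_left power_mult_distrib mult_ac power_divide)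
  also have "(\<Sum>D\<in>Pow W. (\<Prod>e\<in>D. (1 - t) * ?p) * (\<Prod>e\<in>W - D. t)) = (\<Prod>e\<in>W. (1 - t) * ?p + t)"
    using assms(4) by (rule prod_add[symmetric])
  also have "\<dots> = (t + (1 - t) * ?p) ^ card W" by (simp add: add.commute)
  finally show ?thesis .
qed

section \<open>Claimed edges and the distribution of plays\<close>

lemma finite_board [simp]: "finite (board n)" and card_board: "card (board n) = n * n"
  by (simp_all add: board_def)

lemma finite_unclaimed [simp]: "finite (unclaimed n h)"
  by (simp add: unclaimed_def)

lemma breaker_edges_Nil [simp]: "breaker_edges [] = {}"
  and maker_edges_Nil [simp]: "maker_edges [] = {}"
  and breaker_edges_append1 [simp]: "breaker_edges (h @ [(B, x)]) = breaker_edges h \<union> B"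
  and maker_edges_append1: "maker_edges (h @ [(B, x)]) = maker_edges h \<union> set_option x"
  by (auto simp: breaker_edges_def maker_edges_def elem_set)

lemma set_breaker_move:
  "set_pmf (breaker_move n b h) = {B. B \<subseteq> unclaimed n h \<and> card B = min b (card (unclaimed n h))}"
  unfolding breaker_move_def
proof (rule set_pmf_of_set)
  show "{B. B \<subseteq> unclaimed n h \<and> card B = min b (card (unclaimed n h))} \<noteq> {}"
    using obtain_subset_with_card_n[of "min b (card (unclaimed n h))" "unclaimed n h"] by auto
qed simp

lemma finite_set_play [simp]: "finite (set_pmf (play n b S k))"
  by (induction k) (auto simp: set_breaker_move)

lemma expectation_bind_pmf_finite:
  fixes g :: "'b \<Rightarrow> real"
  assumes "finite (set_pmf p)" "\<And>x. finite (set_pmf (f x))"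
  shows "measure_pmf.expectation (bind_pmf p f) g
           = measure_pmf.expectation p (\<lambda>x. measure_pmf.expectation (f x) g)"
  using assms by (subst pmf_expectation_bind[OF assms(1)])
    (auto simp: integral_measure_pmf[OF assms(1)])

text \<open>While \<open>k * (b + 1) \<le> n * n\<close>, no round is cut short: Breaker takes
  exactly \<open>b\<close> edges and Maker one. The number of unclaimed edges is therefore
  deterministic.\<close>

lemma play_invariants:
  assumes "legal_strategy n S" "k * (b + 1) \<le> n * n" "h \<in> set_pmf (play n b S k)"
  shows "card (unclaimed n h) = n * n - k * (b + 1) \<and> length h = k \<and> maker_edges h \<subseteq> board n"
  using assms(2,3)
proof (induction k arbitrary: h)
  case 0
  then show ?case by (simp add: unclaimed_def card_board)
next
  case (Suc k)
  from Suc.prems obtain h' B where h': "h' \<in> set_pmf (play n b S k)"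
    and B: "B \<in> set_pmf (breaker_move n b h')" and h: "h = h' @ [(B, maker_move n S h' B)]"
    by auto
  have IH: "card (unclaimed n h') = n * n - k * (b + 1)" "length h' = k" "maker_edges h' \<subseteq> board n"
    using Suc.IH[OF _ h'] Suc.prems by auto
  have B': "B \<subseteq> unclaimed n h'" "card B = b"
    using B IH Suc.prems by (auto simp: set_breaker_move)
  have finB: "finite B" using B' finite_subset finite_unclaimed by blast
  have cU: "card (unclaimed n h' - B) = n * n - k * (b + 1) - b"
    using B' IH finB by (simp add: card_Diff_subset)
  then have "card (unclaimed n h' - B) > 0" using Suc.prems by simp
  then have ne: "unclaimed n h' - B \<noteq> {}" by (metis card.empty less_irrefl)
  then have S: "S h' B \<in> unclaimed n h' - B"
    using assms(1) B' by (auto simp: legal_strategy_def)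
  have m: "maker_move n S h' B = Some (S h' B)"
    using ne by (simp add: maker_move_def)
  have "unclaimed n h = unclaimed n h' - B - {S h' B}"
    unfolding h m by (auto simp: unclaimed_def maker_edges_append1)
  then have "card (unclaimed n h) = n * n - k * (b + 1) - b - 1"
    using S cU by (simp add: card_Diff_singleton)
  moreover have "maker_edges h \<subseteq> board n"
    using IH S unfolding h m by (auto simp: maker_edges_append1 unclaimed_def)
  ultimately show ?case using IH by (simp add: h)
qed

section \<open>The probability that Breaker claims a fixed set\<close>

lemma expectation_breaker_move_le:
  fixes t :: real
  assumes "b \<le> card (unclaimed n h)" "card (unclaimed n h) > 0" "finite W" "0 \<le> t" "t \<le> 1"
  shows "measure_pmf.expectation (breaker_move n b h) (\<lambda>B. t ^ card (W - B))
           \<le> (t + (1 - t) * (real b / real (card (unclaimed n h)))) ^ card W"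
proof -
  let ?U = "unclaimed n h"
  let ?S = "{B. B \<subseteq> ?U \<and> card B = b}"
  have S: "?S \<noteq> {}" "finite ?S"
    using obtain_subset_with_card_n[OF assms(1)] by auto
  have cS: "card ?S = card ?U choose b" by (simp add: n_subsets)
  have pos: "real (card ?U choose b) > 0" using assms(1) by simp
  have "measure_pmf.expectation (breaker_move n b h) (\<lambda>B. t ^ card (W - B))
      = (\<Sum>B\<in>?S. t ^ card (W - B)) / real (card ?U choose b)"
    unfolding breaker_move_def using assms(1) S cS
    by (simp add: min_absorb1 integral_pmf_of_set)
  also have "\<dots> \<le> (t + (1 - t) * (real b / real (card ?U))) ^ card W"
    using sum_power_card_diff_le[of ?U b W t] assms pos
    by (simp add: pos_divide_le_eq mult.commute)
  finally show ?thesis .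
qed

text \<open>
  Keeping \<open>t\<close> arbitrary makes the induction on the number of rounds work: one round of the game
  turns \<open>t\<close> into \<open>t + (1 - t) b / u\<close>, where \<open>u\<close> is the number of unclaimed edges. The bound does not
  depend on Maker's strategy.
\<close>

lemma expectation_play_le:
  fixes t :: real
  assumes "legal_strategy n S" "k * (b + 1) \<le> n * n" "finite W" "0 \<le> t" "t \<le> 1" "n > 0"
  shows "measure_pmf.expectation (play n b S k) (\<lambda>h. t ^ card (W - breaker_edges h))
           \<le> (1 - (1 - t) * (real (n * n - k * (b + 1)) / real (n * n))) ^ card W"
  using assms(2,4,5)
proof (induction k arbitrary: t)
  case 0
  then show ?case using assms(6) by simp
next
  case (Suc k)
  define u where "u = n * n - k * (b + 1)"
  have u: "b + 1 \<le> u" using Suc.prems by (simp add: u_def)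
  define t' where "t' = t + (1 - t) * (real b / real u)"
  have bu: "real b / real u \<le> 1" "0 \<le> real b / real u" using u by auto
  have t'0: "0 \<le> t'" unfolding t'_def using Suc.prems bu by simp
  have one_minus_t': "1 - t' = (1 - t) * (1 - real b / real u)"
    by (simp add: t'_def algebra_simps)
  have t'1: "t' \<le> 1"
    using mult_nonneg_nonneg[of "1 - t" "1 - real b / real u"] one_minus_t' Suc.prems bu by linarith
  have "measure_pmf.expectation (play n b S (Suc k)) (\<lambda>h. t ^ card (W - breaker_edges h))
      = measure_pmf.expectation (play n b S k) (\<lambda>h. measure_pmf.expectation (breaker_move n b h)
          (\<lambda>B. t ^ card (W - breaker_edges h - B)))"
    unfolding play.simps
    by (subst expectation_bind_pmf_finite) (simp_all add: set_breaker_move Diff_eq Int_assoc)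
  also have "\<dots> \<le> measure_pmf.expectation (play n b S k) (\<lambda>h. t' ^ card (W - breaker_edges h))"
  proof (rule integral_mono_AE)
    show "AE h in measure_pmf (play n b S k).
        measure_pmf.expectation (breaker_move n b h) (\<lambda>B. t ^ card (W - breaker_edges h - B))
          \<le> t' ^ card (W - breaker_edges h)"
    proof (rule AE_pmfI)
      fix h assume h: "h \<in> set_pmf (play n b S k)"
      have "card (unclaimed n h) = u"
        using play_invariants[OF assms(1) _ h] Suc.prems by (simp add: u_def)
      then show "measure_pmf.expectation (breaker_move n b h) (\<lambda>B. t ^ card (W - breaker_edges h - B))
          \<le> t' ^ card (W - breaker_edges h)"
        using expectation_breaker_move_le[of b n h "W - breaker_edges h" t] u assms(3) Suc.prems
        by (simp add: t'_def)
    qed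
  qed (simp_all add: integrable_measure_pmf_finite)
  also have "\<dots> \<le> (1 - (1 - t') * (real u / real (n * n))) ^ card W"
    unfolding u_def using Suc.prems t'0 t'1 by (intro Suc.IH) auto
  \<comment> \<open>The bounds telescope: \<open>(1 - t') * u = (1 - t) * (u - b)\<close>, and
    \<open>u - b - 1\<close> edges are unclaimed after the round. Only Maker's single edge is given
    away.\<close>
  also have "\<dots> \<le> (1 - (1 - t) * (real (n * n - Suc k * (b + 1)) / real (n * n))) ^ card W"
  proof (rule power_mono)
    have "(1 - t') * (real u / real (n * n)) = (1 - t) * ((real u - real b) / real (n * n))"
    proof -
      have "(1 - real b / real u) * real u = real u - real b"
        using u by (simp add: left_diff_distrib)
      then show ?thesis unfolding one_minus_t' by (metis mult.assoc times_divide_eq_right)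
    qed
    moreover have "(1 - t) * (real (n * n - Suc k * (b + 1)) / real (n * n))
        \<le> (1 - t) * ((real u - real b) / real (n * n))"
    proof (intro mult_left_mono divide_right_mono)
      have "n * n - Suc k * (b + 1) = u - b - 1" by (simp add: u_def)
      then show "real (n * n - Suc k * (b + 1)) \<le> real u - real b" using u by linarith
    qed (use Suc.prems in auto)
    ultimately show "1 - (1 - t') * (real u / real (n * n))
        \<le> 1 - (1 - t) * (real (n * n - Suc k * (b + 1)) / real (n * n))" by linarith
    have "real u \<le> real (n * n)" unfolding u_def by (intro of_nat_mono) simp
    then have "real u / real (n * n) \<le> 1" using assms(6) by (simp only: divide_le_eq_1) simp
    then have "(1 - t') * (real u / real (n * n)) \<le> 1"
      using t'0 t'1 by (intro mult_le_one) auto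
    then show "0 \<le> 1 - (1 - t') * (real u / real (n * n))" by simp
  qed
  finally show ?case .
qed

text \<open>At \<open>t = 0\<close> the power in the previous bound is the indicator of the event,
  because \<open>0 ^ 0 = 1\<close>.\<close>

lemma prob_breaker_claims_le:
  assumes "legal_strategy n S" "k * (b + 1) \<le> n * n" "finite W" "n > 0"
  shows "measure_pmf.prob (play n b S k) {h. W \<subseteq> breaker_edges h}
           \<le> (real (k * (b + 1)) / real (n * n)) ^ card W"
proof -
  have "measure_pmf.prob (play n b S k) {h. W \<subseteq> breaker_edges h}
      = measure_pmf.expectation (play n b S k) (indicator {h. W \<subseteq> breaker_edges h})"
    by simp
  also have "indicator {h. W \<subseteq> breaker_edges h} = (\<lambda>h. 0 ^ card (W - breaker_edges h) :: real)"
    using assms(3) by (auto simp: fun_eq_iff indicator_def power_0_left)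
  also have "measure_pmf.expectation (play n b S k) \<dots>
      \<le> (1 - (1 - 0) * (real (n * n - k * (b + 1)) / real (n * n))) ^ card W"
    using assms by (intro expectation_play_le) auto
  also have "1 - (1 - 0) * (real (n * n - k * (b + 1)) / real (n * n)) = real (k * (b + 1)) / real (n * n)"
    using assms(2,4) by (simp add: of_nat_diff field_simps)
  finally show ?thesis .
qed

section \<open>Edge sets that must not lie in Breaker's graph\<close>

text \<open>The sizes are exact because a larger complete bipartite graph or star contains one of
  these, and because the union bound needs families whose members have one common size.\<close>

definition obstructions :: "nat \<Rightarrow> nat \<Rightarrow> edge set set" where
  "obstructions n m =
     {A \<times> B |A B. A \<subseteq> {..<n} \<and> card A = m \<and> B \<subseteq> {..<n} \<and> card B = m} \<union>
     {{i} \<times> B |i B. i < n \<and> B \<subseteq> {..<n} \<and> card B = n - m} \<union>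
     {A \<times> {j} |A j. j < n \<and> A \<subseteq> {..<n} \<and> card A = n - m}"

definition unobstructed :: "nat \<Rightarrow> nat \<Rightarrow> edge set \<Rightarrow> bool" where
  "unobstructed n m C \<longleftrightarrow> (\<forall>W\<in>obstructions n m. \<not> W \<subseteq> C)"

lemma unobstructed_mono: "unobstructed n m C \<Longrightarrow> C' \<subseteq> C \<Longrightarrow> unobstructed n m C'"
  unfolding unobstructed_def by blast

lemma unobstructed_box:
  assumes "unobstructed n m C" "A \<subseteq> {..<n}" "B \<subseteq> {..<n}" "m \<le> card A" "m \<le> card B"
  shows "\<exists>x\<in>A. \<exists>y\<in>B. (x, y) \<notin> C"
proof -
  obtain A' where A': "A' \<subseteq> A" "card A' = m" using obtain_subset_with_card_n[OF assms(4)] by metis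
  obtain B' where B': "B' \<subseteq> B" "card B' = m" using obtain_subset_with_card_n[OF assms(5)] by metis
  have "A' \<times> B' \<in> obstructions n m"
    unfolding obstructions_def using A' B' assms(2,3)
    by (intro UnI1 CollectI exI[of _ A'] exI[of _ B']) auto
  then have "\<not> A' \<times> B' \<subseteq> C" using assms(1) by (auto simp: unobstructed_def)
  then show ?thesis using A' B' by auto
qed

lemma card_ge_of_no_large_subset:
  assumes "m \<le> n" and "\<And>Y. Y \<subseteq> {..<n} \<Longrightarrow> card Y = n - m \<Longrightarrow> \<not> Y \<subseteq> P"
  shows "m \<le> card ({..<n} - P)"
proof (rule ccontr)
  assume "\<not> m \<le> card ({..<n} - P)"
  moreover have "card ({..<n} - P) + card ({..<n} \<inter> P) = n"
    using card_Diff_subset_Int[of "{..<n}" P] card_mono[of "{..<n}" "{..<n} \<inter> P"] by simp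
  ultimately have "n - m \<le> card ({..<n} \<inter> P)" by linarith
  then obtain Y where "Y \<subseteq> {..<n} \<inter> P" "card Y = n - m"
    using obtain_subset_with_card_n by metis
  then show False using assms(2)[of Y] by blast
qed

text \<open>Meant for raising a degree that is still below \<open>m\<close>: with \<open>F\<close>
  the neighbours that Maker already has, the edge found belongs to neither player.\<close>

lemma unobstructed_row:
  assumes "unobstructed n m C" "m \<le> n" "i < n" "finite F" "card F < m"
  shows "\<exists>y<n. (i, y) \<notin> C \<and> y \<notin> F"
proof -
  have "m \<le> card ({..<n} - {y. (i, y) \<in> C})"
  proof (rule card_ge_of_no_large_subset[OF assms(2)])
    fix Y assume Y: "Y \<subseteq> {..<n}" "card Y = n - m"
    then have "{i} \<times> Y \<in> obstructions n m" using assms(3) unfolding obstructions_def by blast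
    then have "\<not> {i} \<times> Y \<subseteq> C" using assms(1) by (auto simp: unobstructed_def)
    then show "\<not> Y \<subseteq> {y. (i, y) \<in> C}" by auto
  qed
  then have "\<not> {..<n} - {y. (i, y) \<in> C} \<subseteq> F"
    using card_mono[OF assms(4)] assms(5) by (meson leD le_trans)
  then show ?thesis by auto
qed

lemma unobstructed_column:
  assumes "unobstructed n m C" "m \<le> n" "j < n" "finite F" "card F < m"
  shows "\<exists>x<n. (x, j) \<notin> C \<and> x \<notin> F"
proof -
  have "m \<le> card ({..<n} - {x. (x, j) \<in> C})"
  proof (rule card_ge_of_no_large_subset[OF assms(2)])
    fix Y assume Y: "Y \<subseteq> {..<n}" "card Y = n - m"
    then have "Y \<times> {j} \<in> obstructions n m" using assms(3) unfolding obstructions_def by blast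
    then have "\<not> Y \<times> {j} \<subseteq> C" using assms(1) by (auto simp: unobstructed_def)
    then show "\<not> Y \<subseteq> {x. (x, j) \<in> C}" by auto
  qed
  then have "\<not> {..<n} - {x. (x, j) \<in> C} \<subseteq> F"
    using card_mono[OF assms(4)] assms(5) by (meson leD le_trans)
  then show ?thesis by auto
qed

section \<open>The greedy phase and the augmenting phase\<close>

text \<open>
  A partial matching is encoded as a permutation \<open>p\<close> together with the set \<open>D\<close> of those rows \<open>i\<close>
  for which the edge \<open>(i, p i)\<close> may be missing. The parameter \<open>r\<close> is the number of rounds that
  Maker still needs.
\<close>

definition greedy_phase :: "nat \<Rightarrow> nat \<Rightarrow> nat \<Rightarrow> edge set \<Rightarrow> bool" where
  "greedy_phase n m r E \<longleftrightarrow> (\<exists>p D. p permutes {..<n} \<and> D \<subseteq> {..<n} \<and>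
     E = (\<lambda>i. (i, p i)) ` ({..<n} - D) \<and> m \<le> card D \<and> r = card D + 2 * m * m)"

text \<open>As \<open>p\<close> also pairs each uncovered row \<open>i\<close> with an uncovered
  column \<open>p i\<close>, the degrees missing at both ends can be charged to \<open>i\<close>.
  Truncated subtraction ignores degrees above \<open>m\<close>.\<close>

definition deficit :: "nat \<Rightarrow> edge set \<Rightarrow> (nat \<Rightarrow> nat) \<Rightarrow> nat \<Rightarrow> nat" where
  "deficit m E p i = (m - card (E `` {i})) + (m - card (E\<inverse> `` {p i}))"

text \<open>One round is budgeted per augmentation and one per missing edge. The cost is only
  bounded by \<open>r\<close>, since one edge may lower two deficits and one switch may settle
  several rows.\<close>

definition augmenting_phase :: "nat \<Rightarrow> nat \<Rightarrow> nat \<Rightarrow> edge set \<Rightarrow> bool" where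
  "augmenting_phase n m r E \<longleftrightarrow> (\<exists>p D. p permutes {..<n} \<and> D \<subseteq> {..<n} \<and>
     (\<forall>i\<in>{..<n} - D. (i, p i) \<in> E) \<and> card D + (\<Sum>i\<in>D. deficit m E p i) \<le> r)"

definition on_track :: "nat \<Rightarrow> nat \<Rightarrow> nat \<Rightarrow> edge set \<Rightarrow> bool" where
  "on_track n m r E \<longleftrightarrow> greedy_phase n m r E \<or> augmenting_phase n m r E"

lemma finite_Image_edges: "E \<subseteq> board n \<Longrightarrow> finite (E `` X)" "E \<subseteq> board n \<Longrightarrow> finite (E\<inverse> `` X)"
  by (auto intro: finite_subset[of _ "{..<n}"] simp: board_def)

lemma deficit_antimono:
  assumes "E \<subseteq> E'" "E' \<subseteq> board n"
  shows "deficit m E' p i \<le> deficit m E p i"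
proof -
  have "card (E `` {i}) \<le> card (E' `` {i})" "card (E\<inverse> `` {p i}) \<le> card (E'\<inverse> `` {p i})"
    using assms by (auto intro!: card_mono finite_Image_edges)
  then show ?thesis unfolding deficit_def by linarith
qed

text \<open>The source of the budget \<open>2 * m * m\<close>: each of the \<open>m\<close>
  uncovered pairs lacks at most \<open>m\<close> edges at either end.\<close>

lemma augmenting_phase_after_greedy:
  assumes "p permutes {..<n}" "D \<subseteq> {..<n}" "E = (\<lambda>i. (i, p i)) ` ({..<n} - D)" "card D = m"
  shows "augmenting_phase n m (m + 2 * m * m) E"
proof -
  have "(\<Sum>i\<in>D. deficit m E p i) \<le> (\<Sum>i\<in>D. 2 * m)"
    by (intro sum_mono) (simp add: deficit_def)
  then show ?thesis using assms unfolding augmenting_phase_def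
    by (intro exI[of _ p] exI[of _ D]) (auto simp: algebra_simps)
qed

text \<open>\<open>D\<close> and its image under \<open>p\<close> have more than \<open>m\<close>
  vertices each, so some edge \<open>(x, p z)\<close> between them is not Breaker's. Composing
  \<open>p\<close> with the transposition of \<open>x\<close> and \<open>z\<close> gives
  \<open>x\<close> this edge and leaves the pairs outside \<open>D\<close> alone.\<close>

lemma greedy_step:
  assumes "p permutes {..<n}" "D \<subseteq> {..<n}" "E = (\<lambda>i. (i, p i)) ` ({..<n} - D)"
    and "m < card D" "Suc r = card D + 2 * m * m" "unobstructed n m C"
  shows "\<exists>e\<in>board n - (C \<union> E). greedy_phase n m r (insert e E)"
proof -
  have inj: "inj p" using assms(1) permutes_inj by blast
  have "card (p ` D) = card D" using inj by (intro card_image) (auto intro: inj_on_subset)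
  moreover have pD: "p ` D \<subseteq> {..<n}"
    using image_mono[OF assms(2), of p] permutes_image[OF assms(1)] by simp
  ultimately obtain x z where x: "x \<in> D" and z: "z \<in> D" and xz: "(x, p z) \<notin> C"
    using unobstructed_box[OF assms(6,2), of "p ` D"] assms(4) by auto
  define q where "q = p \<circ> Transposition.transpose x z"
  have q: "q permutes {..<n}" unfolding q_def
    using assms(1,2) x z by (intro permutes_compose permutes_swap_id) auto
  have qx: "q x = p z" by (simp add: q_def)
  have qi: "q i = p i" if "i \<notin> D" for i using that x z by (auto simp: q_def Transposition.transpose_def)
  have "{..<n} - (D - {x}) = insert x ({..<n} - D)" using x assms(2) by auto
  then have "insert (x, p z) E = (\<lambda>i. (i, q i)) ` ({..<n} - (D - {x}))"
    using qx qi assms(3) by (auto simp: image_iff)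
  moreover have "card (D - {x}) = card D - 1" using x by simp
  ultimately have "greedy_phase n m r (insert (x, p z) E)"
    unfolding greedy_phase_def using q assms(2,4,5)
    by (intro exI[of _ q] exI[of _ "D - {x}"]) auto
  moreover have "(x, p z) \<in> board n" 
    using x z assms(2) pD by (auto simp: board_def)
  moreover have "(x, p z) \<notin> E" using x assms(3) by auto
  ultimately show ?thesis using xz by blast
qed

text \<open>Besides \<open>u\<close>, all rows of \<open>D\<close> whose edge under \<open>q\<close>
  is present are dropped. The remaining rows keep their columns, so their deficits cannot grow,
  while the number of rows falls by at least one.\<close>

lemma augmenting_step_remove:
  assumes "p permutes {..<n}" "D \<subseteq> {..<n}" "E \<subseteq> E'" "E' \<subseteq> board n"
    and "card D + (\<Sum>i\<in>D. deficit m E p i) \<le> Suc r" "u \<in> D"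
    and "q permutes {..<n}" "\<forall>i\<in>{..<n} - (D - {u}). (i, q i) \<in> E'"
    and "\<And>i. i \<in> D - {u} \<Longrightarrow> q i = p i \<or> (i, q i) \<in> E'"
  shows "augmenting_phase n m r E'"
proof -
  define D' where "D' = {i \<in> D - {u}. (i, q i) \<notin> E'}"
  have finD: "finite D" using assms(2) finite_subset by blast
  have "D' \<subset> D" using assms(6) by (auto simp: D'_def)
  then have "card D' < card D" using finD psubset_card_mono by blast
  moreover have "(\<Sum>i\<in>D'. deficit m E' q i) \<le> (\<Sum>i\<in>D. deficit m E p i)"
  proof -
    have "(\<Sum>i\<in>D'. deficit m E' q i) \<le> (\<Sum>i\<in>D'. deficit m E p i)"
    proof (rule sum_mono)
      fix i assume "i \<in> D'"
      then have "q i = p i" using assms(9)[of i] by (auto simp: D'_def)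
      then have "deficit m E' q i = deficit m E' p i" by (simp add: deficit_def)
      then show "deficit m E' q i \<le> deficit m E p i" using deficit_antimono assms(3,4) by metis
    qed
    also have "\<dots> \<le> (\<Sum>i\<in>D. deficit m E p i)"
      using finD \<open>D' \<subset> D\<close> by (intro sum_mono2) auto
    finally show ?thesis .
  qed
  ultimately have "card D' + (\<Sum>i\<in>D'. deficit m E' q i) \<le> r" using assms(5) by linarith
  moreover have "\<forall>i\<in>{..<n} - D'. (i, q i) \<in> E'" using assms(8) by (auto simp: D'_def)
  ultimately show ?thesis unfolding augmenting_phase_def
    using assms(2,7) \<open>D' \<subset> D\<close> by (intro exI[of _ q] exI[of _ D']) auto
qed

lemma augmenting_step_deficit:
  assumes "p permutes {..<n}" "D \<subseteq> {..<n}" "E \<subseteq> E'" "E' \<subseteq> board n"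
    and "\<forall>i\<in>{..<n} - D. (i, p i) \<in> E"
    and "card D + (\<Sum>i\<in>D. deficit m E p i) \<le> Suc r" "u \<in> D"
    and "deficit m E' p u < deficit m E p u"
  shows "augmenting_phase n m r E'"
proof -
  have "(\<Sum>i\<in>D. deficit m E' p i) < (\<Sum>i\<in>D. deficit m E p i)"
  proof (rule sum_strict_mono_ex1)
    show "finite D" using assms(2) finite_subset by blast
    show "\<forall>i\<in>D. deficit m E' p i \<le> deficit m E p i" using deficit_antimono[OF assms(3,4)] by blast
    show "\<exists>i\<in>D. deficit m E' p i < deficit m E p i" using assms(7,8) by blast
  qed
  then have "card D + (\<Sum>i\<in>D. deficit m E' p i) \<le> r" using assms(6) by linarith
  then show ?thesis unfolding augmenting_phase_def
    using assms(1,2,3,5) by (intro exI[of _ p] exI[of _ D]) auto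
qed

lemma augmenting_phase_step:
  assumes "augmenting_phase n m (Suc r) E" "E \<subseteq> board n" "m \<le> n" "unobstructed n m C"
    and "board n - (C \<union> E) \<noteq> {}"
  shows "\<exists>e\<in>board n - (C \<union> E). augmenting_phase n m r (insert e E)"
proof -
  obtain p D where p: "p permutes {..<n}" and D: "D \<subseteq> {..<n}"
    and good: "\<forall>i\<in>{..<n} - D. (i, p i) \<in> E"
    and cost: "card D + (\<Sum>i\<in>D. deficit m E p i) \<le> Suc r"
    using assms(1) unfolding augmenting_phase_def by auto
  \<comment> \<open>A filler move for rounds in which no particular edge is required.\<close>
  obtain e0 where e0: "e0 \<in> board n - (C \<union> E)" using assms(5) by blast
  have p_lt: "p i < n \<longleftrightarrow> i < n" for i using permutes_in_image[OF p, of i] by simp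
  note finE = finite_Image_edges[OF assms(2)]
  \<comment> \<open>Any \<open>u\<close> in \<open>D\<close> falls under one of the last four cases.
    The case \<open>present\<close> can occur because an edge claimed to raise a degree may happen
    to join \<open>u\<close> to \<open>p u\<close>.\<close>
  consider (empty) "D = {}"
    | (row) u where "u \<in> D" "card (E `` {u}) < m"
    | (column) u where "u \<in> D" "card (E\<inverse> `` {p u}) < m"
    | (present) u where "u \<in> D" "(u, p u) \<in> E"
    | (augment) u where "u \<in> D" "(u, p u) \<notin> E" "m \<le> card (E `` {u})" "m \<le> card (E\<inverse> `` {p u})"
    by (meson ex_in_conv not_le)
  then show ?thesis
  proof cases
    case empty
    then have "augmenting_phase n m r (insert e0 E)"
      unfolding augmenting_phase_def using p good by (intro exI[of _ p] exI[of _ "{}"]) auto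
    then show ?thesis using e0 by blast
  next
    case row
    then obtain y where y: "y < n" "(u, y) \<notin> C" "(u, y) \<notin> E"
      using unobstructed_row[OF assms(4,3), of u "E `` {u}"] D finE by auto
    have board: "(u, y) \<in> board n" using y row D by (auto simp: board_def)
    have "insert (u, y) E `` {u} = insert y (E `` {u})" by auto
    then have "card (insert (u, y) E `` {u}) = Suc (card (E `` {u}))" using y finE by simp
    moreover have "card (E\<inverse> `` {p u}) \<le> card ((insert (u, y) E)\<inverse> `` {p u})"
      using assms(2) board by (intro card_mono finite_Image_edges[where n = n]) auto
    ultimately have "deficit m (insert (u, y) E) p u < deficit m E p u"
      using row unfolding deficit_def by linarith
    then have "augmenting_phase n m r (insert (u, y) E)"
      using board assms(2) row by (intro augmenting_step_deficit[OF p D _ _ good cost]) auto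
    then show ?thesis using board y by blast
  next
    case column
    then obtain x where x: "x < n" "(x, p u) \<notin> C" "(x, p u) \<notin> E"
      using unobstructed_column[OF assms(4,3), of "p u" "E\<inverse> `` {p u}"] D finE p_lt by auto
    have board: "(x, p u) \<in> board n" using x column D p_lt by (auto simp: board_def)
    have "(insert (x, p u) E)\<inverse> `` {p u} = insert x (E\<inverse> `` {p u})" by auto
    then have "card ((insert (x, p u) E)\<inverse> `` {p u}) = Suc (card (E\<inverse> `` {p u}))" using x finE by simp
    moreover have "card (E `` {u}) \<le> card (insert (x, p u) E `` {u})"
      using assms(2) board by (intro card_mono finite_Image_edges[where n = n]) auto
    ultimately have "deficit m (insert (x, p u) E) p u < deficit m E p u"
      using column unfolding deficit_def by linarith
    then have "augmenting_phase n m r (insert (x, p u) E)"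
      using board assms(2) column by (intro augmenting_step_deficit[OF p D _ _ good cost]) auto
    then show ?thesis using board x by blast
  next
    case present
    have "augmenting_phase n m r (insert e0 E)"
      using e0 assms(2) present good
      by (intro augmenting_step_remove[OF p D _ _ cost present(1) p]) auto
    then show ?thesis using e0 by blast
  next
    case augment
    \<comment> \<open>\<open>X\<close> and \<open>Y\<close> hold the partners under \<open>p\<close>
      of the neighbours of \<open>u\<close> and of \<open>p u\<close>. A partner that is only
      formal, its row lying in \<open>D\<close>, does no harm: after the switch the rows
      \<open>u\<close>, \<open>x\<close> and \<open>z\<close> all have actual edges.\<close>
    define X where "X = inv p ` (E `` {u})"
    define Y where "Y = p ` (E\<inverse> `` {p u})"
    have inj: "inj p" "inj (inv p)" using p permutes_inj permutes_inv by blast+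
    have pinv: "p (inv p y) = y" for y using p permutes_inverses by metis
    have X: "X \<subseteq> {..<n}" "m \<le> card X"
    proof -
      show "X \<subseteq> {..<n}" using assms(2) p_lt pinv by (force simp: X_def board_def)
      show "m \<le> card X" unfolding X_def using augment inj(2) by (subst card_image) (auto intro: inj_on_subset)
    qed
    have Y: "Y \<subseteq> {..<n}" "m \<le> card Y"
    proof -
      show "Y \<subseteq> {..<n}" using assms(2) p_lt by (force simp: Y_def board_def)
      show "m \<le> card Y" unfolding Y_def using augment inj(1) by (subst card_image) (auto intro: inj_on_subset)
    qed
    obtain x y where x: "x \<in> X" and y: "y \<in> Y" and xy: "(x, y) \<notin> C"
      using unobstructed_box[OF assms(4) X(1) Y(1) X(2) Y(2)] by auto
    have ux: "(u, p x) \<in> E" using x pinv by (auto simp: X_def)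
    obtain z where z: "y = p z" "(z, p u) \<in> E" using y by (auto simp: Y_def)
    have xu: "x \<noteq> u" "z \<noteq> u" using ux z augment by auto
    have lt: "x < n" "z < n" "u < n" using X x assms(2) z augment D by (auto simp: board_def)
    \<comment> \<open>The connecting edge may already be Maker's; the round then goes to the filler
      move.\<close>
    define e where "e = (if (x, p z) \<in> E then e0 else (x, p z))"
    have e: "e \<in> board n - (C \<union> E)"
      using e0 xy z lt p_lt by (auto simp: e_def board_def)
    have xz: "(x, p z) \<in> insert e E" by (auto simp: e_def)
    \<comment> \<open>switch along the path from \<open>u\<close> via \<open>p x\<close>, \<open>x\<close>, \<open>p z\<close>, \<open>z\<close> to \<open>p u\<close>; it is
      shorter if \<open>x = z\<close>\<close>
    define q where "q = (if x = z then p(u := p x, x := p u) else p(u := p x, x := p z, z := p u))"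
    \<comment> \<open>The switch composes \<open>p\<close> with a 3-cycle, or with a transposition
      if \<open>x = z\<close>, so \<open>q\<close> is again a permutation.\<close>
    have q_comp: "q = (if x = z then p \<circ> Transposition.transpose u x else p \<circ> (Transposition.transpose u z \<circ> Transposition.transpose u x))"
      using xu by (auto simp: q_def fun_eq_iff Transposition.transpose_def)
    have q: "q permutes {..<n}"
      unfolding q_comp using p lt by (auto intro!: permutes_compose permutes_swap_id)
    have new: "(u, q u) \<in> insert e E" "(x, q x) \<in> insert e E" "(z, q z) \<in> insert e E"
      using ux xz z xu by (auto simp: q_def)
    have old: "q i = p i" if "i \<notin> {u, x, z}" for i using that by (auto simp: q_def)
    have "augmenting_phase n m r (insert e E)"
    proof (rule augmenting_step_remove[OF p D _ _ cost augment(1) q])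
      show "\<forall>i\<in>{..<n} - (D - {u}). (i, q i) \<in> insert e E"
        using new old good by (metis Diff_iff empty_iff insertCI insertE)
      show "q i = p i \<or> (i, q i) \<in> insert e E" if "i \<in> D - {u}" for i
        using new old[of i] by auto
    qed (use e assms(2) in auto)
    then show ?thesis using e by blast
  qed
qed

lemma on_track_step:
  assumes "on_track n m (Suc r) E" "E \<subseteq> board n" "m \<le> n" "unobstructed n m C"
    and "board n - (C \<union> E) \<noteq> {}"
  shows "\<exists>e\<in>board n - (C \<union> E). on_track n m r (insert e E)"
proof (cases "augmenting_phase n m (Suc r) E")
  case True
  then show ?thesis using augmenting_phase_step[OF _ assms(2-5)] by (auto simp: on_track_def)
next
  case False
  then obtain p D where "p permutes {..<n}" "D \<subseteq> {..<n}" "E = (\<lambda>i. (i, p i)) ` ({..<n} - D)"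
    "m \<le> card D" "Suc r = card D + 2 * m * m"
    using assms(1) unfolding on_track_def greedy_phase_def by auto
  \<comment> \<open>At \<open>card D = m\<close> the greedy state already counts as augmenting with
    the same number of rounds left, so greedy moves are needed only above \<open>m\<close>.\<close>
  moreover from this have "card D \<noteq> m"
    using augmenting_phase_after_greedy False by metis
  ultimately have "\<exists>e\<in>board n - (C \<union> E). greedy_phase n m r (insert e E)"
    using assms(4) by (intro greedy_step) auto
  then show ?thesis by (auto simp: on_track_def)
qed

lemma on_track_start: "m \<le> n \<Longrightarrow> on_track n m (n + 2 * m * m) {}"
  unfolding on_track_def greedy_phase_def
  by (intro disjI1 exI[of _ id] exI[of _ "{..<n}"]) (auto simp: permutes_id)

text \<open>With no rounds left, \<open>m > 0\<close> rules out the greedy phase, and a cost of 0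
  forces \<open>D\<close> to be empty, so the graph of \<open>p\<close> is the matching.\<close>

lemma on_track_finish:
  assumes "on_track n m 0 E" "m > 0"
  shows "\<exists>M\<subseteq>E. perfect_matching n M"
proof -
  have "augmenting_phase n m 0 E"
    using assms by (auto simp: on_track_def greedy_phase_def)
  then obtain p D where p: "p permutes {..<n}" and D: "D \<subseteq> {..<n}" "card D = 0"
    and E: "\<forall>i\<in>{..<n} - D. (i, p i) \<in> E"
    unfolding augmenting_phase_def by auto
  have "D = {}" using D finite_subset by fastforce
  let ?M = "(\<lambda>i. (i, p i)) ` {..<n}"
  have "?M \<subseteq> E" using E \<open>D = {}\<close> by auto
  moreover have "perfect_matching n ?M"
    unfolding perfect_matching_def
  proof (intro conjI allI impI)
    show "?M \<subseteq> board n" using permutes_in_image[OF p] by (auto simp: board_def)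
    show "\<exists>!e. e \<in> ?M \<and> fst e = i" if "i < n" for i using that by auto
    show "\<exists>!e. e \<in> ?M \<and> snd e = j" if "j < n" for j
    proof -
      obtain i where j: "j = p i" using permutes_surj[OF p] by (metis surjD)
      have "i < n" using that j permutes_in_image[OF p, of i] by simp
      moreover have "inj p" using p permutes_inj by blast
      ultimately show ?thesis by (intro ex1I[of _ "(i, p i)"]) (auto simp: j inj_eq)
    qed
  qed
  ultimately show ?thesis by blast
qed

section \<open>Maker's strategy\<close>

text \<open>The fallback to any free edge makes the strategy legal on every history, including
  obstructed ones. \<open>Suc\<close> counts the round in progress.\<close>

definition maker_strategy :: "nat \<Rightarrow> nat \<Rightarrow> strategy" where
  "maker_strategy n m h B =
     (let F = unclaimed n h - B;
          G = {e \<in> F. on_track n m (n + 2 * m * m - Suc (length h)) (insert e (maker_edges h))}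
      in if G = {} then SOME e. e \<in> F else SOME e. e \<in> G)"

lemma legal_maker_strategy: "legal_strategy n (maker_strategy n m)"
  unfolding legal_strategy_def
proof (intro allI impI)
  fix h B assume "unclaimed n h - B \<noteq> {}"
  then show "maker_strategy n m h B \<in> unclaimed n h - B"
    using some_in_eq[of "unclaimed n h - B"]
      some_in_eq[of "{e \<in> unclaimed n h - B.
        on_track n m (n + 2 * m * m - Suc (length h)) (insert e (maker_edges h))}"]
    unfolding maker_strategy_def Let_def by (smt (verit) mem_Collect_eq)
qed

lemma on_track_maker_strategy:
  assumes "\<exists>e\<in>unclaimed n h - B. on_track n m (n + 2 * m * m - Suc (length h)) (insert e (maker_edges h))"
  shows "on_track n m (n + 2 * m * m - Suc (length h)) (insert (maker_strategy n m h B) (maker_edges h))"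
proof -
  let ?G = "{e \<in> unclaimed n h - B. on_track n m (n + 2 * m * m - Suc (length h)) (insert e (maker_edges h))}"
  have "?G \<noteq> {}" using assms by blast
  then have "maker_strategy n m h B \<in> ?G"
    using some_in_eq[of ?G] unfolding maker_strategy_def Let_def by (smt (verit))
  then show ?thesis by blast
qed

text \<open>Breaker's graph only grows, so being unobstructed at the end passes to every earlier
  round and Maker always has a suitable move. The bound on \<open>n * n\<close> ensures that a free
  edge remains.\<close>

lemma play_on_track:
  assumes "m \<le> n" "(n + 2 * m * m) * (b + 1) \<le> n * n" "k \<le> n + 2 * m * m"
    and "h \<in> set_pmf (play n b (maker_strategy n m) k)" "unobstructed n m (breaker_edges h)"
  shows "on_track n m (n + 2 * m * m - k) (maker_edges h)"
  using assms(3-5)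
proof (induction k arbitrary: h)
  case 0
  then show ?case using on_track_start[OF assms(1)] by simp
next
  case (Suc k)
  let ?S = "maker_strategy n m" and ?K = "n + 2 * m * m"
  from Suc.prems obtain h' B where h': "h' \<in> set_pmf (play n b ?S k)"
    and B: "B \<in> set_pmf (breaker_move n b h')" and h: "h = h' @ [(B, maker_move n ?S h' B)]"
    by auto
  have "Suc k * (b + 1) \<le> ?K * (b + 1)" using Suc.prems by (intro mult_le_mono1) auto
  then have bound: "Suc k * (b + 1) \<le> n * n" using assms(2) by linarith
  have inv: "card (unclaimed n h') = n * n - k * (b + 1)" "length h' = k" "maker_edges h' \<subseteq> board n"
    using play_invariants[OF legal_maker_strategy _ h'] bound by auto
  have B': "B \<subseteq> unclaimed n h'" "card B = b"
    using B inv bound by (auto simp: set_breaker_move)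
  have "card B < card (unclaimed n h')" using B' inv bound by simp
  then have ne: "unclaimed n h' - B \<noteq> {}" using B' by auto
  \<comment> \<open>Maker answers after seeing \<open>B\<close>, so his options are measured against
    Breaker's edges including the current move.\<close>
  have free: "unclaimed n h' - B = board n - (breaker_edges h \<union> maker_edges h')"
    by (auto simp: h unclaimed_def)
  have "unobstructed n m (breaker_edges h')"
    using Suc.prems(3) by (rule unobstructed_mono) (auto simp: h)
  then have "on_track n m (?K - k) (maker_edges h')"
    using Suc.IH[OF _ h'] Suc.prems(1) by simp
  moreover have "?K - k = Suc (?K - Suc k)" using Suc.prems(1) by simp
  ultimately have "on_track n m (Suc (?K - Suc k)) (maker_edges h')" by simp
  then have "\<exists>e\<in>unclaimed n h' - B. on_track n m (?K - Suc k) (insert e (maker_edges h'))"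
    using on_track_step[OF _ inv(3) assms(1) Suc.prems(3)] ne unfolding free by blast
  then have "on_track n m (?K - Suc k) (insert (?S h' B) (maker_edges h'))"
    using on_track_maker_strategy[of n h' B m] unfolding inv(2) by blast
  then show ?case using ne by (simp add: h maker_move_def maker_edges_append1)
qed

section \<open>The union bound over obstructions\<close>

lemma prob_breaker_claims_some_le:
  fixes q N :: real
  assumes "legal_strategy n S" "k * (b + 1) \<le> n * n" "n > 0"
    and "real (k * (b + 1)) \<le> q * real (n * n)"
    and "finite \<W>" "\<And>W. W \<in> \<W> \<Longrightarrow> finite W \<and> card W = c" "real (card \<W>) \<le> N"
  shows "measure_pmf.prob (play n b S k) {h. \<exists>W\<in>\<W>. W \<subseteq> breaker_edges h} \<le> N * q ^ c"
proof -
  let ?P = "measure_pmf.prob (play n b S k)"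
  have q: "real (k * (b + 1)) / real (n * n) \<le> q" 
    using assms(3,4) by (simp add: pos_divide_le_eq)
  then have q0: "0 \<le> q" by (meson divide_nonneg_nonneg of_nat_0_le_iff order_trans)
  have "{h. \<exists>W\<in>\<W>. W \<subseteq> breaker_edges h} = (\<Union>W\<in>\<W>. {h. W \<subseteq> breaker_edges h})" by auto
  then have "?P {h. \<exists>W\<in>\<W>. W \<subseteq> breaker_edges h} \<le> (\<Sum>W\<in>\<W>. ?P {h. W \<subseteq> breaker_edges h})"
    using assms(5) by (simp only:) (rule measure_pmf.finite_measure_subadditive_finite, auto)
  also have "\<dots> \<le> (\<Sum>W\<in>\<W>. q ^ c)"
  proof (rule sum_mono)
    fix W assume "W \<in> \<W>"
    then have W: "finite W" "card W = c" using assms(6) by auto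
    have "?P {h. W \<subseteq> breaker_edges h} \<le> (real (k * (b + 1)) / real (n * n)) ^ card W"
      using prob_breaker_claims_le[OF assms(1,2) W(1) assms(3)] .
    also have "\<dots> \<le> q ^ card W" using q by (intro power_mono) auto
    finally show "?P {h. W \<subseteq> breaker_edges h} \<le> q ^ c" using W by simp
  qed
  also have "\<dots> \<le> N * q ^ c" using assms(7) q0 by (simp add: mult_right_mono)
  finally show ?thesis .
qed

lemma binomial_le_power: "k \<le> n \<Longrightarrow> real (n choose k) \<le> real n ^ k"
  using binomial_le_pow[of k n] by (metis of_nat_le_iff of_nat_power)

text \<open>The first term accounts for at most \<open>n ^ (2 * m)\<close> complete bipartite graphs
  with \<open>m * m\<close> edges each, the second for stars with \<open>n - m\<close> edges centred
  in either part.\<close>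

lemma prob_obstructed_le:
  fixes q :: real
  assumes "legal_strategy n S" "k * (b + 1) \<le> n * n" "n > 0" "m \<le> n"
    and "real (k * (b + 1)) \<le> q * real (n * n)"
  shows "measure_pmf.prob (play n b S k) {h. \<not> unobstructed n m (breaker_edges h)}
           \<le> (real n ^ 2 * q ^ m) ^ m + 2 * (real n ^ (m + 1) * q ^ (n - m))"
proof -
  let ?P = "measure_pmf.prob (play n b S k)"
  let ?sub = "\<lambda>j. {A. A \<subseteq> {..<n} \<and> card A = j}"
  define W1 where "W1 = (\<lambda>(A, B). A \<times> B) ` (?sub m \<times> ?sub m)"
  define W2 where "W2 = (\<lambda>(i, B). {i} \<times> B) ` ({..<n} \<times> ?sub (n - m))"
  define W3 where "W3 = (\<lambda>(j, A). A \<times> {j}) ` ({..<n} \<times> ?sub (n - m))"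
  have obs: "obstructions n m = W1 \<union> W2 \<union> W3"
    unfolding obstructions_def W1_def W2_def W3_def by (auto simp: image_iff) 
  have fin: "finite W1" "finite W2" "finite W3"
    unfolding W1_def W2_def W3_def by auto
  have fins: "finite A" if "A \<subseteq> {..<n}" for A using that finite_subset by blast
  have cards: "card (?sub j) = n choose j" for j using n_subsets[of "{..<n}" j] by simp
  have "card W1 \<le> (n choose m) * (n choose m)"
    unfolding W1_def using card_image_le[of "?sub m \<times> ?sub m" "\<lambda>(A, B). A \<times> B"]
    by (simp add: card_cartesian_product cards)
  then have "real (card W1) \<le> real (n choose m) * real (n choose m)"
    by (metis of_nat_le_iff of_nat_mult)
  also have "\<dots> \<le> real n ^ m * real n ^ m"
    using binomial_le_power[OF assms(4)] by (intro mult_mono) auto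
  finally have c1: "real (card W1) \<le> real n ^ m * real n ^ m" .
  \<comment> \<open>Counting the leaves left out of a star instead of those in it keeps the number
    of stars at \<open>n ^ (m + 1)\<close>.\<close>
  have sym: "n choose (n - m) = n choose m" using binomial_symmetric[OF assms(4)] by simp
  have small: "real c \<le> real n ^ (m + 1)" if "c \<le> n * (n choose m)" for c
  proof -
    have "real c \<le> real n * real (n choose m)" using that by (metis of_nat_le_iff of_nat_mult)
    also have "\<dots> \<le> real n * real n ^ m"
      using binomial_le_power[OF assms(4)] by (intro mult_left_mono) auto
    finally show ?thesis by simp
  qed
  have "card W2 \<le> n * (n choose m)"
    unfolding W2_def using card_image_le[of "{..<n} \<times> ?sub (n - m)" "\<lambda>(i, B). {i} \<times> B"]
    by (simp add: card_cartesian_product cards sym)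
  then have c2: "real (card W2) \<le> real n ^ (m + 1)" by (rule small)
  have "card W3 \<le> n * (n choose m)"
    unfolding W3_def using card_image_le[of "{..<n} \<times> ?sub (n - m)" "\<lambda>(j, A). A \<times> {j}"]
    by (simp add: card_cartesian_product cards sym)
  then have c3: "real (card W3) \<le> real n ^ (m + 1)" by (rule small)
  let ?E = "\<lambda>\<W>. {h. \<exists>W\<in>\<W>. W \<subseteq> breaker_edges h}"
  have p1: "?P (?E W1) \<le> (real n ^ m * real n ^ m) * q ^ (m * m)"
    by (rule prob_breaker_claims_some_le[OF assms(1,2,3,5) fin(1) _ c1])
       (auto simp: W1_def card_cartesian_product fins)
  have p2: "?P (?E W2) \<le> real n ^ (m + 1) * q ^ (n - m)"
    by (rule prob_breaker_claims_some_le[OF assms(1,2,3,5) fin(2) _ c2])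
       (auto simp: W2_def card_cartesian_product fins)
  have p3: "?P (?E W3) \<le> real n ^ (m + 1) * q ^ (n - m)"
    by (rule prob_breaker_claims_some_le[OF assms(1,2,3,5) fin(3) _ c3])
       (auto simp: W3_def card_cartesian_product fins)
  have "{h. \<not> unobstructed n m (breaker_edges h)} = ?E W1 \<union> ?E W2 \<union> ?E W3"
    unfolding unobstructed_def obs by auto
  then have "?P {h. \<not> unobstructed n m (breaker_edges h)} \<le> ?P (?E W1 \<union> ?E W2) + ?P (?E W3)"
    by (simp add: measure_Un_le)
  also have "\<dots> \<le> ?P (?E W1) + ?P (?E W2) + ?P (?E W3)"
    by (simp add: measure_Un_le)
  also have "\<dots> \<le> (real n ^ m * real n ^ m) * q ^ (m * m) + 2 * (real n ^ (m + 1) * q ^ (n - m))"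
    using p1 p2 p3 by linarith
  also have "(real n ^ m * real n ^ m) * q ^ (m * m) = (real n ^ 2 * q ^ m) ^ m"
    by (simp add: power_mult_distrib power2_eq_square power_mult)
  finally show ?thesis .
qed

text \<open>The last assumption serves twice: with \<open>q \<le> 1\<close> it keeps the board from
  running out within the budget, and it bounds by \<open>q\<close> the factor per edge in the union
  bound.\<close>

lemma prob_win_within_ge:
  fixes q :: real
  assumes "0 < m" "m \<le> n" "q \<le> 1"
    and "real (n + 2 * m * m) * (real b + 1) \<le> q * real n ^ 2"
  shows "prob_win_within n b (maker_strategy n m) (n + 2 * m * m)
           \<ge> 1 - ((real n ^ 2 * q ^ m) ^ m + 2 * (real n ^ (m + 1) * q ^ (n - m)))"
proof -
  let ?K = "n + 2 * m * m"
  let ?p = "play n b (maker_strategy n m) ?K"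
  have q: "real (?K * (b + 1)) \<le> q * real (n * n)"
    using assms(4) by (simp add: power2_eq_square algebra_simps)
  also have "\<dots> \<le> real (n * n)" using mult_right_mono[OF assms(3), of "real (n * n)"] by simp
  finally have le: "?K * (b + 1) \<le> n * n" by (simp only: of_nat_le_iff)
  have win: "maker_wins n h" if "h \<in> set_pmf ?p" "unobstructed n m (breaker_edges h)" for h
  proof -
    have "on_track n m (?K - ?K) (maker_edges h)"
      using that by (intro play_on_track[OF assms(2) le]) auto
    then show ?thesis unfolding maker_wins_def using on_track_finish assms(1) by simp
  qed
  have "1 - measure_pmf.prob ?p {h. maker_wins n h} = measure_pmf.prob ?p {h. \<not> maker_wins n h}"
    using measure_pmf.prob_compl[of "{h. maker_wins n h}" ?p]
    by (simp add: Collect_neg_eq Compl_eq_Diff_UNIV)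
  also have "\<dots> \<le> measure_pmf.prob ?p {h. \<not> unobstructed n m (breaker_edges h)}"
    using win by (intro measure_pmf.finite_measure_mono_AE) (auto simp: AE_measure_pmf_iff)
  also have "\<dots> \<le> (real n ^ 2 * q ^ m) ^ m + 2 * (real n ^ (m + 1) * q ^ (n - m))"
    using assms by (intro prob_obstructed_le[OF legal_maker_strategy le _ assms(2) q]) simp
  finally show ?thesis unfolding prob_win_within_def by linarith
qed

section \<open>Asymptotics and conclusion\<close>

text \<open>As \<open>m n\<close> outgrows \<open>ln n\<close>, \<open>exp (- c * m n)\<close> beats
  \<open>n ^ 2\<close>; as \<open>m n * ln n\<close> is of smaller order than \<open>n\<close>, the
  stars are negligible too. Replacing \<open>m n\<close> by the power of \<open>n\<close> or that
  power minus 1 removes the floor from the limits.\<close>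

lemma failure_bound_tendsto_0:
  fixes c :: real and m :: "nat \<Rightarrow> nat"
  assumes "c > 0" "\<And>n. m n = nat \<lfloor>real n powr (1 / 3)\<rfloor>"
  shows "(\<lambda>n. (real n ^ 2 * exp (- c) ^ m n) ^ m n
            + 2 * (real n ^ (m n + 1) * exp (- c) ^ (n - m n))) \<longlonglongrightarrow> 0"
proof -
  have m_up: "real (m n) \<le> real n powr (1 / 3)" for n
    unfolding assms(2) by simp
  have m_lo: "real n powr (1 / 3) - 1 \<le> real (m n)" for n
    unfolding assms(2) by linarith
  have t1: "(\<lambda>n. real n ^ 2 * exp (- c * (real n powr (1 / 3) - 1))) \<longlonglongrightarrow> 0"
    using assms(1) by real_asymp
  have t2: "(\<lambda>n. exp ((real n powr (1 / 3) + 1) * ln (real n) - c * (real n - real n powr (1 / 3)))) \<longlonglongrightarrow> 0"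
    using assms(1) by real_asymp
  have small: "\<forall>\<^sub>F n in sequentially. real n ^ 2 * exp (- c * (real n powr (1 / 3) - 1)) < 1"
    using order_tendstoD(2)[OF t1, of 1] by simp
  have upper: "\<forall>\<^sub>F n in sequentially. (real n ^ 2 * exp (- c) ^ m n) ^ m n
            + 2 * (real n ^ (m n + 1) * exp (- c) ^ (n - m n))
       \<le> real n ^ 2 * exp (- c * (real n powr (1 / 3) - 1))
          + 2 * exp ((real n powr (1 / 3) + 1) * ln (real n) - c * (real n - real n powr (1 / 3)))"
    using small eventually_ge_at_top[of 1]
  proof eventually_elim
    case (elim n)
    have n: "real n \<ge> 1" using elim by simp
    have "real n powr (1 / 3) \<ge> 1" using n by (simp add: ge_one_powr_ge_zero)
    then have m1: "m n \<ge> 1" unfolding assms(2) by (simp add: le_nat_floor)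
    have "real n powr (1 / 3) \<le> real n powr 1" using n by (intro powr_mono) auto
    then have mn: "real (m n) \<le> real n" using m_up[of n] n by simp
    let ?x = "real n ^ 2 * exp (- c) ^ m n"
    have "exp (- c) ^ m n = exp (- c * real (m n))"
      by (simp add: exp_of_nat_mult[symmetric] mult.commute)
    also have "\<dots> \<le> exp (- c * (real n powr (1 / 3) - 1))"
      using m_lo[of n] assms(1) by simp
    finally have x: "?x \<le> real n ^ 2 * exp (- c * (real n powr (1 / 3) - 1))"
      by (intro mult_left_mono) auto
    then have "?x \<le> 1" using elim by linarith
    then have "?x ^ m n \<le> ?x ^ 1" using m1 by (intro power_decreasing) auto
    then have first: "?x ^ m n \<le> real n ^ 2 * exp (- c * (real n powr (1 / 3) - 1))" using x by simp
    have "real n ^ (m n + 1) * exp (- c) ^ (n - m n)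
        = exp (real (m n + 1) * ln (real n)) * exp (real (n - m n) * - c)"
      using n by (simp only: exp_of_nat_mult exp_ln)
    also have "\<dots> = exp ((real (m n) + 1) * ln (real n) - c * (real n - real (m n)))"
      using mn by (simp add: exp_add[symmetric] of_nat_diff algebra_simps)
    also have "\<dots> \<le> exp ((real n powr (1 / 3) + 1) * ln (real n) - c * (real n - real n powr (1 / 3)))"
    proof -
      have "(real (m n) + 1) * ln (real n) \<le> (real n powr (1 / 3) + 1) * ln (real n)"
        using m_up[of n] n by (intro mult_right_mono) auto
      moreover have "c * (real n - real n powr (1 / 3)) \<le> c * (real n - real (m n))"
        using m_up[of n] assms(1) by (intro mult_left_mono) auto
      ultimately show ?thesis by simp
    qed
    finally show ?case using first by linarith
  qed
  have upper_lim: "(\<lambda>n. real n ^ 2 * exp (- c * (real n powr (1 / 3) - 1))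
          + 2 * exp ((real n powr (1 / 3) + 1) * ln (real n) - c * (real n - real n powr (1 / 3)))) \<longlonglongrightarrow> 0"
    using tendsto_add[OF t1 tendsto_mult_left[OF t2, of 2]] by simp
  have lower: "\<forall>\<^sub>F n in sequentially. 0 \<le> (real n ^ 2 * exp (- c) ^ m n) ^ m n
            + 2 * (real n ^ (m n + 1) * exp (- c) ^ (n - m n))"
    by (intro always_eventually allI) simp
  show ?thesis by (rule tendsto_sandwich[OF lower upper tendsto_const upper_lim])
qed

theorem theorem3p3:
  fixes \<epsilon> :: real
  assumes "\<epsilon> > 0"
  shows "\<exists>(S :: nat \<Rightarrow> strategy) (\<delta> :: nat \<Rightarrow> real).
           (\<forall>n. legal_strategy n (S n)) \<and>
           \<delta> \<longlonglongrightarrow> 0 \<and>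
           (\<lambda>n. prob_win_within n (nat \<lfloor>(1 - \<epsilon>) * real n\<rfloor>) (S n)
                  (nat \<lfloor>(1 + \<delta> n) * real n\<rfloor>)) \<longlonglongrightarrow> 1"
proof -
  \<comment> \<open>The exponent \<open>1 / 3\<close> lets \<open>m n\<close> outgrow
    \<open>ln n\<close>, as the union bound requires, while its square stays of smaller order than
    \<open>n\<close>.\<close>
  define m :: "nat \<Rightarrow> nat" where "m n = nat \<lfloor>real n powr (1 / 3)\<rfloor>" for n
  define S where "S n = maker_strategy n (m n)" for n
  \<comment> \<open>Chosen so that \<open>(1 + \<delta> n) * n\<close> is exactly the budget
    \<open>n + 2 * m n * m n\<close> for \<open>n > 0\<close>.\<close>
  define \<delta> where "\<delta> n = 2 * real (m n) * real (m n) / real n" for n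
  \<comment> \<open>The cap at \<open>1 / 2\<close> keeps \<open>1 - d\<close> positive, so
    \<open>(1 - d) * n\<close> bounds \<open>b n\<close> even for \<open>\<epsilon> > 1\<close>,
    where \<open>nat\<close> rounds a negative number up to 0.\<close>
  define d where "d = min \<epsilon> (1 / 2)"
  \<comment> \<open>The gap \<open>d / 2\<close> between \<open>1 - d\<close> and \<open>q\<close>
    absorbs the extra rounds and Maker's own edges for large \<open>n\<close>.\<close>
  define q where "q = 1 - d / 2"
  define c where "c = - ln q"
  define b where "b n = nat \<lfloor>(1 - \<epsilon>) * real n\<rfloor>" for n
  have d: "0 < d" "d \<le> 1 / 2" "d \<le> \<epsilon>" using assms by (auto simp: d_def)
  have q: "0 < q" "q < 1" using d by (auto simp: q_def)
  have c: "c > 0" "q = exp (- c)" using q by (auto simp: c_def ln_less_zero)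
  have m_up: "real (m n) \<le> real n powr (1 / 3)" for n unfolding m_def by simp
  have mm: "2 * real (m n) * real (m n) \<le> 2 * real n powr (1 / 3) * real n powr (1 / 3)" for n
    using m_up[of n] by (intro mult_mono) auto
  have b_up: "real (b n) \<le> (1 - d) * real n" for n
  proof -
    have "(1 - \<epsilon>) * real n \<le> (1 - d) * real n" "0 \<le> (1 - d) * real n"
      using d by (auto intro: mult_right_mono)
    then show ?thesis unfolding b_def by linarith
  qed
  have \<delta>0: "\<delta> \<longlonglongrightarrow> 0"
  proof (rule tendsto_sandwich[OF _ _ tendsto_const])
    show "(\<lambda>n. 2 * real n powr (1 / 3) * real n powr (1 / 3) / real n) \<longlonglongrightarrow> 0" by real_asymp
    show "\<forall>\<^sub>F n in sequentially. \<delta> n \<le> 2 * real n powr (1 / 3) * real n powr (1 / 3) / real n"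
      unfolding \<delta>_def using mm by (intro always_eventually allI divide_right_mono) auto
  qed (auto simp: \<delta>_def)
  define f where "f n = (real n ^ 2 * q ^ m n) ^ m n + 2 * (real n ^ (m n + 1) * q ^ (n - m n))" for n
  have f0: "f \<longlonglongrightarrow> 0"
    using failure_bound_tendsto_0[OF c(1), of m] unfolding f_def c(2) m_def by simp
  have "\<forall>\<^sub>F n in sequentially. (real n + 2 * real n powr (1 / 3) * real n powr (1 / 3)) *
      ((1 - d) * real n + 1) \<le> (1 - d / 2) * real n ^ 2"
    using d by real_asymp
  then have lower: "\<forall>\<^sub>F n in sequentially. 1 - f n \<le> prob_win_within n (b n) (S n) (nat \<lfloor>(1 + \<delta> n) * real n\<rfloor>)"
    using eventually_ge_at_top[of 1]
  proof eventually_elim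
    case (elim n)
    have n: "real n \<ge> 1" using elim by simp
    have "real n powr (1 / 3) \<ge> 1" using n by (simp add: ge_one_powr_ge_zero)
    then have m1: "m n > 0" unfolding m_def by (simp add: le_nat_floor)
    have "real n powr (1 / 3) \<le> real n powr 1" using n by (intro powr_mono) auto
    then have mn: "m n \<le> n" using m_up[of n] n by simp
    have "(1 + \<delta> n) * real n = real (n + 2 * m n * m n)"
      using n by (simp add: \<delta>_def algebra_simps)
    then have K: "nat \<lfloor>(1 + \<delta> n) * real n\<rfloor> = n + 2 * m n * m n" by (simp only: floor_of_nat nat_int)
    have "real (n + 2 * m n * m n) * (real (b n) + 1)
        \<le> (real n + 2 * real n powr (1 / 3) * real n powr (1 / 3)) * ((1 - d) * real n + 1)"
      using mm[of n] b_up[of n] by (intro mult_mono) auto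
    also have "\<dots> \<le> q * real n ^ 2" using elim by (simp add: q_def)
    finally show ?case
      unfolding K f_def S_def using q by (intro prob_win_within_ge[OF m1 mn]) auto
  qed
  have lower_lim: "(\<lambda>n. 1 - f n) \<longlonglongrightarrow> 1"
    using tendsto_diff[OF tendsto_const f0, of 1] by simp
  have upper: "\<forall>\<^sub>F n in sequentially.
      prob_win_within n (b n) (S n) (nat \<lfloor>(1 + \<delta> n) * real n\<rfloor>) \<le> 1"
    unfolding prob_win_within_def by (intro always_eventually allI measure_pmf.prob_le_1)
  note win = tendsto_sandwich[OF lower upper lower_lim tendsto_const]
  have "\<forall>n. legal_strategy n (S n)" unfolding S_def using legal_maker_strategy by blast
  then show ?thesis
    by (intro exI[of _ S] exI[of _ \<delta>] conjI \<delta>0 win[unfolded b_def])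
qed

end
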